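(* Let $\tilde\Gamma$ be a path on the fixed-point bundle $E$ of ${\rm VI}(F,\Delta)$ with finitely many segments, ending at $(\sigma^\star,\mathbf 0)$, with $\tilde\Gamma\cap S\subseteq\{(\sigma^\star,\mathbf 0)\}$; let $\zeta\ge0$, with $\zeta\ne0$ if $J(\sigma^\star)$ is singular, and let $d>0$ be such that $\mathcal N_{\tilde\Gamma}(\zeta)\cap S=\varnothing$. Assume that $F\in C^1(p_\Delta(\mathcal N_{\tilde\Gamma}(\zeta)))$. Let $\mu_{t+1}=(1-\eta)\mu_t$ and $\theta_{t+1}=\theta_t+\overline{d\theta}_t$, $\sigma_t={\rm softmax}(\theta_t)$, $\sigma_{t+1}={\rm softmax}(\theta_{t+1})$, where $\eta\in(0,1)$ and $\overline{d\theta}_t$ is given by $$\left(J(\sigma_t)+(\mathbf 1^\top\mu_t)I\right)\overline{d\theta}_t=(I-\mathbf 1\sigma_t^\top)(d\mu_t/\sigma_t),\qquad d\mu_t=-\eta\mu_t .$$ Then there exists $C_2>0$ such that for any $(\sigma_t,\mu_t)\in\mathcal N_{\tilde\Gamma}(\zeta)$ and any $\eta\in(0,1)$, $$\left\|\tilde G(\sigma_{t+1},\mu_{t+1})-\tilde G(\sigma_t,\mu_t)\right\|\le C_2\eta .$$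
   Context: Notation. $\Delta=\{\sigma\in\mathbb R^n:\sigma\ge0,\ \mathbf 1^\top\sigma=1\}$, $\mathbf 1$ the all-ones vector. Vector inequalities, $\circ$, $/$ and $\ln$ are componentwise; for a matrix $A$ and vector $b$, $A\circ b=A\,{\rm diag}(b)$ and $b\circ A={\rm diag}(b)A$. $\|\cdot\|$ is the Euclidean norm. ${\rm softmax}(\theta)=\exp(\theta)/(\mathbf 1^\top\exp(\theta))$. $F:\Delta\to\mathbb R^n$ is continuously differentiable (with a $C^1$ extension to a neighborhood of $\Delta$). Bundle. $G(\sigma,\mu)=(I-\sigma\mathbf 1^\top)(\sigma\circ F(\sigma)-\mu)$; $\tilde G(\sigma,\mu)=G(\sigma,\mu)/\sigma$ for $\sigma>0$; $E=\{(\sigma,\mu)\in\Delta\times\mathbb R^n:G(\sigma,\mu)=0\}=\{(\sigma,\sigma\circ F(\sigma)+v\sigma):\sigma\in\Delta,\ v\in\mathbb R\}$; $\tilde\mu(\sigma)=(I-\sigma\mathbf 1^\top)(\sigma\circ F(\sigma))$. $$J(\sigma)=(I-\mathbf 1\sigma^\top)\left(\frac{\partial F(\sigma)}{\partial\sigma}\circ\sigma+\left((I-\mathbf 1\sigma^\top)F(\sigma)\right)\circ I\right)(I-\mathbf 1\sigma^\top)+k\mathbf 1\sigma^\top,$$ where $k\ne0$ is a fixed scalar such that $k+\mathbf 1^\top\mu\ne0$ for all $(\sigma,\mu)\in\mathcal N_{\tilde\Gamma}(\zeta)$. The subspace $\ker(\sigma^\top)$ is $J(\sigma)$-invariant; let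 $\lambda_j^\perp(J(\sigma))$ be the real eigenvalues of $J(\sigma)$ other than the eigenvalue $k$ belonging to the eigenvector $\mathbf 1$, i.e. the real eigenvalues of $J(\sigma)|_{\ker(\sigma^\top)}$. The singular manifold is $S=\{(\sigma,\tilde\mu(\sigma)-\lambda_j^\perp(J(\sigma))\sigma):\lambda_j^\perp(J(\sigma))\in\mathbb R,\ \sigma\in\Delta\}$. Path. Given $\sigma_{\rm init}\in\Delta$ with positive entries and sufficiently large $v_{\rm init}$, a path is a set $$\tilde\Gamma=\bigcup_{i=1}^q\{(\sigma,\gamma\mu_i)\in E:\ \mu_i=\gamma_{i-1}\mu_{i-1}+\beta_i\sigma_{i-1},\ \gamma\in[\gamma_i,1]\},$$ with $\gamma_0\mu_0=v_{\rm init}\sigma_{\rm init}$, $(\sigma_0,\gamma_0\mu_0)\in E$, $\beta_i\in\mathbb R$, $\mu_i>0$ and $\gamma_q\mathbf 1^\top\mu_q=0$. Here the $i$-th segment is a curve: $\sigma$ is a continuous function of $\gamma\in[\gamma_i,1]$ that equals $\sigma_{i-1}$ at $\gamma=1$ and $\sigma_i$ at $\gamma=\gamma_i$. The end point is $(\sigma^\star,\mathbf 0)$, where $\sigma^\star=\sigma_q$ is a solution of ${\rm VI}(F,\Delta)$ (i.e. $\langle F(\sigma^\star),\sigma'-\sigma^\star\rangle\ge0$ for all $\sigma'\in\Delta$). (The indices $i$ of the path data are unrelated to the iteration index $t$.) Neighborhood. $\mathcal N_{\tilde\Gamma}(\zeta)$ is the closure of $\{({\rm softmax}(\theta),\mu):\|\theta-\ln\sigma_\mu\|\le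 d,\ (\sigma_\mu,\mu)\in\tilde\Gamma,\ \mathbf 1^\top\mu>\zeta\}$, and $p_\Delta(\mathcal N_{\tilde\Gamma}(\zeta))$ is its projection to the $\sigma$-space. $F\in C^m(X)$ means that $F$ has continuous derivatives up to order $m$ on $X$.
   Formalization: For arbitrary d>0 the claim is false, since J(σ)+(1ᵀμ)I can be singular at points of the neighborhood outside E; the bound is proved for d at most some d₀>0 depending on the path, F, k and ζ, or for any admissible d with that matrix invertible on the neighborhood outside E. *)

theory Defs
  imports "HOL-Analysis.Analysis"
begin

text \<open>On \<^typ>\<open>real ^ 'n\<close> the constant \<open>1\<close> is the all-ones vector and \<open>*\<close> is the componentwise product.\<close>

definition prob_simplex :: "(real ^ 'n) set" where
  "prob_simplex = {\<sigma>. (\<forall>i. 0 \<le> \<sigma> $ i) \<and> (\<Sum>i\<in>UNIV. \<sigma> $ i) = 1}"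

definition sum_entries :: "real ^ 'n \<Rightarrow> real" where
  "sum_entries \<mu> = (\<Sum>i\<in>UNIV. \<mu> $ i)"

definition outer :: "real ^ 'n \<Rightarrow> real ^ 'n \<Rightarrow> real ^ 'n ^ 'n" where
  "outer x y = (\<chi> i j. x $ i * y $ j)"

definition diag :: "real ^ 'n \<Rightarrow> real ^ 'n ^ 'n" where
  "diag v = (\<chi> i j. if i = j then v $ i else 0)"

definition vec_div :: "real ^ 'n \<Rightarrow> real ^ 'n \<Rightarrow> real ^ 'n" where
  "vec_div x y = (\<chi> i. x $ i / y $ i)"

definition vec_ln :: "real ^ 'n \<Rightarrow> real ^ 'n" where
  "vec_ln x = (\<chi> i. ln (x $ i))"

definition softmax :: "real ^ 'n \<Rightarrow> real ^ 'n" where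
  "softmax \<theta> = (\<chi> i. exp (\<theta> $ i) / (\<Sum>j\<in>UNIV. exp (\<theta> $ j)))"

definition C1_on :: "(real ^ 'n) set \<Rightarrow> (real ^ 'n \<Rightarrow> real ^ 'n) \<Rightarrow> bool" where
  "C1_on X F \<longleftrightarrow> (\<forall>x\<in>X. F differentiable (at x)) \<and> continuous_on X (\<lambda>x. jacobian F (at x))"

text \<open>\<open>F\<close> stands for a fixed extension beyond the simplex. \<open>jacobian_J\<close> does not depend on the
  extension: the columns of \<open>diag \<sigma> ** (mat 1 - outer 1 \<sigma>)\<close> have entries summing to \<open>0\<close>,
  so only derivatives tangential to the simplex enter.\<close>

definition C1_near_simplex :: "(real ^ 'n \<Rightarrow> real ^ 'n) \<Rightarrow> bool" where
  "C1_near_simplex F \<longleftrightarrow> (\<exists>U. open U \<and> prob_simplex \<subseteq> U \<and> C1_on U F)"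

definition VI_solution :: "(real ^ 'n \<Rightarrow> real ^ 'n) \<Rightarrow> real ^ 'n \<Rightarrow> bool" where
  "VI_solution F \<sigma> \<longleftrightarrow>
     \<sigma> \<in> prob_simplex \<and> (\<forall>\<sigma>'\<in>prob_simplex. 0 \<le> F \<sigma> \<bullet> (\<sigma>' - \<sigma>))"

definition G :: "(real ^ 'n \<Rightarrow> real ^ 'n) \<Rightarrow> real ^ 'n \<Rightarrow> real ^ 'n \<Rightarrow> real ^ 'n" where
  "G F \<sigma> \<mu> = (mat 1 - outer \<sigma> 1) *v (\<sigma> * F \<sigma> - \<mu>)"

text \<open>Meaningful only for \<open>\<sigma>\<close> with positive entries.\<close>

definition G_tilde :: "(real ^ 'n \<Rightarrow> real ^ 'n) \<Rightarrow> real ^ 'n \<Rightarrow> real ^ 'n \<Rightarrow> real ^ 'n" where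
  "G_tilde F \<sigma> \<mu> = vec_div (G F \<sigma> \<mu>) \<sigma>"

definition fp_bundle :: "(real ^ 'n \<Rightarrow> real ^ 'n) \<Rightarrow> ((real ^ 'n) \<times> (real ^ 'n)) set" where
  "fp_bundle F = {(\<sigma>, \<mu>). \<sigma> \<in> prob_simplex \<and> G F \<sigma> \<mu> = 0}"

definition mu_tilde :: "(real ^ 'n \<Rightarrow> real ^ 'n) \<Rightarrow> real ^ 'n \<Rightarrow> real ^ 'n" where
  "mu_tilde F \<sigma> = (mat 1 - outer \<sigma> 1) *v (\<sigma> * F \<sigma>)"

definition jacobian_J :: "(real ^ 'n \<Rightarrow> real ^ 'n) \<Rightarrow> real \<Rightarrow> real ^ 'n \<Rightarrow> real ^ 'n ^ 'n" where
  "jacobian_J F k \<sigma> =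
     (mat 1 - outer 1 \<sigma>)
       ** (jacobian F (at \<sigma>) ** diag \<sigma> + diag ((mat 1 - outer 1 \<sigma>) *v F \<sigma>))
       ** (mat 1 - outer 1 \<sigma>)
     + k *\<^sub>R outer 1 \<sigma>"

text \<open>The real eigenvalues of the restriction of \<open>jacobian_J F k \<sigma>\<close> to the invariant subspace
  orthogonal to \<open>\<sigma>\<close>.\<close>

definition perp_eigenvalues :: "(real ^ 'n \<Rightarrow> real ^ 'n) \<Rightarrow> real \<Rightarrow> real ^ 'n \<Rightarrow> real set" where
  "perp_eigenvalues F k \<sigma> =
     {l. \<exists>x. x \<noteq> 0 \<and> \<sigma> \<bullet> x = 0 \<and> jacobian_J F k \<sigma> *v x = l *\<^sub>R x}"

definition singular_manifold ::
    "(real ^ 'n \<Rightarrow> real ^ 'n) \<Rightarrow> real \<Rightarrow> ((real ^ 'n) \<times> (real ^ 'n)) set" where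
  "singular_manifold F k =
     {(\<sigma>, mu_tilde F \<sigma> - l *\<^sub>R \<sigma>) | \<sigma> l. \<sigma> \<in> prob_simplex \<and> l \<in> perp_eigenvalues F k \<sigma>}"

text \<open>\<open>\<Gamma>\<close> is a path ending at \<open>(\<sigma>_end, 0)\<close>. The curve \<open>c i\<close> is \<open>\<sigma>\<close> as a function of the scaling
  parameter on the \<open>i\<close>-th segment; naming it selects one branch when the bundle has several points
  over the same \<open>\<mu>\<close>. Every \<open>v_init\<close> for which the remaining conditions can be met is admitted, so that
  no threshold for ``sufficiently large'' has to be chosen.\<close>

definition bundle_path ::
    "(real ^ 'n \<Rightarrow> real ^ 'n) \<Rightarrow> ((real ^ 'n) \<times> (real ^ 'n)) set \<Rightarrow> real ^ 'n \<Rightarrow> bool" where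
  "bundle_path F \<Gamma> \<sigma>_end \<longleftrightarrow>
     (\<exists>(q::nat) (v_init::real) \<sigma>_init (\<gamma>::nat \<Rightarrow> real) \<mu> (\<beta>::nat \<Rightarrow> real) \<sigma> (c::nat \<Rightarrow> real \<Rightarrow> real ^ 'n).
        1 \<le> q \<and>
        \<sigma>_init \<in> prob_simplex \<and> (\<forall>j. 0 < \<sigma>_init $ j) \<and>
        \<gamma> 0 *\<^sub>R \<mu> 0 = v_init *\<^sub>R \<sigma>_init \<and>
        (\<sigma> 0, \<gamma> 0 *\<^sub>R \<mu> 0) \<in> fp_bundle F \<and>
        (\<forall>i\<in>{1..q}.
           \<gamma> i \<le> 1 \<and>
           \<mu> i = \<gamma> (i - 1) *\<^sub>R \<mu> (i - 1) + \<beta> i *\<^sub>R \<sigma> (i - 1) \<and>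
           (\<forall>j. 0 < \<mu> i $ j) \<and>
           continuous_on {\<gamma> i..1} (c i) \<and>
           c i 1 = \<sigma> (i - 1) \<and> c i (\<gamma> i) = \<sigma> i \<and>
           (\<forall>g\<in>{\<gamma> i..1}. (c i g, g *\<^sub>R \<mu> i) \<in> fp_bundle F)) \<and>
        \<gamma> q * sum_entries (\<mu> q) = 0 \<and>
        \<sigma>_end = \<sigma> q \<and> VI_solution F \<sigma>_end \<and>
        \<Gamma> = (\<Union>i\<in>{1..q}. (\<lambda>g. (c i g, g *\<^sub>R \<mu> i)) ` {\<gamma> i..1}))"

definition path_nbhd ::
    "((real ^ 'n) \<times> (real ^ 'n)) set \<Rightarrow> real \<Rightarrow> real \<Rightarrow> ((real ^ 'n) \<times> (real ^ 'n)) set" where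
  "path_nbhd \<Gamma> d \<zeta> =
     closure {(softmax \<theta>, \<mu>) | \<theta> \<mu> \<sigma>\<^sub>\<mu>.
       norm (\<theta> - vec_ln \<sigma>\<^sub>\<mu>) \<le> d \<and> (\<sigma>\<^sub>\<mu>, \<mu>) \<in> \<Gamma> \<and> \<zeta> < sum_entries \<mu>}"

text \<open>The linear system that determines the update of \<open>\<theta>\<close>.\<close>

definition system_matrix ::
    "(real ^ 'n \<Rightarrow> real ^ 'n) \<Rightarrow> real \<Rightarrow> real ^ 'n \<Rightarrow> real ^ 'n \<Rightarrow> real ^ 'n ^ 'n" where
  "system_matrix F k \<sigma> \<mu> = jacobian_J F k \<sigma> + sum_entries \<mu> *\<^sub>R mat 1"

definition path_step ::
    "(real ^ 'n \<Rightarrow> real ^ 'n) \<Rightarrow> real \<Rightarrow> real \<Rightarrow>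
     real ^ 'n \<Rightarrow> real ^ 'n \<Rightarrow> real ^ 'n \<Rightarrow> real ^ 'n \<Rightarrow> bool" where
  "path_step F k \<eta> \<theta> \<mu> \<theta>' \<mu>' \<longleftrightarrow>
     \<mu>' = (1 - \<eta>) *\<^sub>R \<mu> \<and>
     (\<exists>d\<theta>. system_matrix F k (softmax \<theta>) \<mu> *v d\<theta>
             = (mat 1 - outer 1 (softmax \<theta>)) *v vec_div (- \<eta> *\<^sub>R \<mu>) (softmax \<theta>) \<and>
           \<theta>' = \<theta> + d\<theta>)"

text \<open>The singular manifold lies inside the bundle, so a neighbourhood of a path that avoids it can
  still contain points off the bundle at which the system matrix is singular; near these the update
  is unbounded. For \<open>n = 2\<close>, \<open>F \<sigma> = (\<sigma>\<^sub>1 - 1/2, 0)\<close> and the path with constant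
  \<open>\<sigma> = (1/2, 1/2)\<close> and \<open>\<mu> = (m/2, m/2)\<close>, this happens at \<open>\<sigma> = (9/10, 1/10)\<close>, \<open>m = 23/100\<close>.
  Neighbourhoods of sufficiently small radius contain no such points.\<close>

definition regular_off_bundle ::
    "(real ^ 'n \<Rightarrow> real ^ 'n) \<Rightarrow> real \<Rightarrow> ((real ^ 'n) \<times> (real ^ 'n)) set \<Rightarrow> bool" where
  "regular_off_bundle F k N \<longleftrightarrow> (\<forall>(\<sigma>, \<mu>) \<in> N - fp_bundle F. invertible (system_matrix F k \<sigma> \<mu>))"

end

theory Submission
  imports Defs
begin

text \<open>
  At a bundle point the kernel of the system matrix is trivial: \<open>\<sigma>\<close> is a left eigenvector of
  \<open>J(\<sigma>)\<close> for \<open>k\<close>, so a kernel vector is orthogonal to \<open>\<sigma>\<close> unless \<open>k + 1\<^sup>T \<mu> = 0\<close>, and then it is an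
  eigenvector for \<open>- 1\<^sup>T \<mu>\<close>, which puts the point on the singular manifold. Small neighbourhoods
  stay close to the compact part of the path with \<open>1\<^sup>T \<mu> \<ge> \<zeta>\<close>, so they inherit the trivial kernel, and
  by compactness the inverse is uniformly bounded. Along the path \<open>\<mu> / \<sigma> = F(\<sigma>) + v\<close> is bounded, hence
  also on the neighbourhood, because \<open>\<sigma>\<close> changes there by a bounded factor at most. So the update of
  \<open>\<theta>\<close> is of order \<open>\<eta>\<close>, and \<open>F(\<sigma>) - \<mu> / \<sigma>\<close> changes by order \<open>\<eta>\<close> although \<open>\<sigma>\<close> may approach the
  boundary of the simplex.
\<close>

section \<open>Elementary estimates and continuity rules\<close>

lemma exp_minus_1_le:
  fixes x :: real
  shows "exp x - 1 \<le> x * exp x"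
proof -
  have "(1 - x) * exp x \<le> exp (- x) * exp x"
    using exp_ge_add_one_self[of "- x"] by (intro mult_right_mono) auto
  then show ?thesis by (simp add: algebra_simps flip: exp_add)
qed

lemma norm_le_card_bound:
  fixes x :: "real ^ 'n"
  assumes "\<And>i. \<bar>x $ i\<bar> \<le> b"
  shows "norm x \<le> real CARD('n) * b"
  using norm_le_l1_cart[of x] sum_bounded_above[of UNIV "\<lambda>i. \<bar>x $ i\<bar>" b] assms by simp

lemma sum_entries_eq_inner: "sum_entries x = x \<bullet> 1"
  by (simp add: sum_entries_def inner_vec_def)

lemma sum_entries_scaleR: "sum_entries (c *\<^sub>R x) = c * sum_entries x"
  by (simp add: sum_entries_eq_inner)

lemma continuous_on_sum_entries [continuous_intros]:
  "continuous_on S f \<Longrightarrow> continuous_on S (\<lambda>x. sum_entries (f x))"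
  unfolding sum_entries_def by (intro continuous_intros)

lemma continuous_on_vec_times [continuous_intros]:
  fixes f g :: "'a::topological_space \<Rightarrow> real ^ 'n"
  assumes "continuous_on S f" "continuous_on S g"
  shows "continuous_on S (\<lambda>x. f x * g x)"
  unfolding times_vec_def by (intro continuous_intros assms)

lemma continuous_on_matrix_vector_mult [continuous_intros]:
  fixes A :: "'a::topological_space \<Rightarrow> real ^ 'n ^ 'm"
  assumes "continuous_on S A" "continuous_on S f"
  shows "continuous_on S (\<lambda>x. A x *v f x)"
  unfolding matrix_vector_mult_def by (intro continuous_intros assms)

subsection \<open>The simplex and softmax\<close>

lemma prob_simplexD:
  assumes "\<sigma> \<in> prob_simplex"
  shows "0 \<le> \<sigma> $ i" "(\<Sum>i\<in>UNIV. \<sigma> $ i) = 1" "\<sigma> \<bullet> 1 = 1" "norm \<sigma> \<le> 1"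
proof -
  show *: "0 \<le> \<sigma> $ i" "(\<Sum>i\<in>UNIV. \<sigma> $ i) = 1" for i
    using assms by (auto simp: prob_simplex_def)
  then show "\<sigma> \<bullet> 1 = 1" by (simp add: inner_vec_def)
  show "norm \<sigma> \<le> 1" using norm_le_l1_cart[of \<sigma>] * by simp
qed

lemma compact_prob_simplex: "compact (prob_simplex :: (real ^ 'n) set)"
proof -
  have eq: "prob_simplex = {\<sigma> :: real ^ 'n. \<forall>i. 0 \<le> \<sigma> $ i} \<inter> {\<sigma>. (\<Sum>i\<in>UNIV. \<sigma> $ i) = 1}"
    by (auto simp: prob_simplex_def)
  have "closed (prob_simplex :: (real ^ 'n) set)"
    unfolding eq
    by (intro closed_Int closed_Collect_all closed_Collect_le closed_Collect_eq continuous_intros)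
  moreover have "bounded (prob_simplex :: (real ^ 'n) set)"
    using prob_simplexD(4) by (auto intro: boundedI)
  ultimately show ?thesis by (simp add: compact_eq_bounded_closed)
qed

lemma convex_prob_simplex: "convex (prob_simplex :: (real ^ 'n) set)"
  by (auto simp: convex_def prob_simplex_def sum.distrib simp flip: sum_distrib_left)

lemma sum_entries_bounds:
  assumes "\<sigma> \<in> prob_simplex" "\<And>i. 0 \<le> \<mu> $ i" "\<And>i. \<mu> $ i \<le> A * \<sigma> $ i"
  shows "0 \<le> sum_entries \<mu>" "sum_entries \<mu> \<le> A"
proof -
  show "0 \<le> sum_entries \<mu>" unfolding sum_entries_def by (intro sum_nonneg assms)
  have "sum_entries \<mu> \<le> (\<Sum>i\<in>UNIV. A * \<sigma> $ i)"
    unfolding sum_entries_def by (intro sum_mono assms)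
  also have "\<dots> = A" using prob_simplexD(2)[OF assms(1)] by (simp flip: sum_distrib_left)
  finally show "sum_entries \<mu> \<le> A" .
qed

lemma sum_exp_pos: "0 < (\<Sum>j\<in>(UNIV :: 'n::finite set). exp (\<theta> j :: real))"
  by (intro sum_pos) auto

lemma softmax_pos: "0 < softmax \<theta> $ i"
  using sum_exp_pos[of "\<lambda>j. \<theta> $ j"] by (simp add: softmax_def)

lemma softmax_in_prob_simplex: "softmax \<theta> \<in> prob_simplex"
proof -
  have "(\<Sum>i\<in>UNIV. softmax \<theta> $ i) = 1"
    using sum_exp_pos[of "\<lambda>j. \<theta> $ j"] by (simp add: softmax_def flip: sum_divide_distrib)
  then show ?thesis using softmax_pos[of \<theta>] by (auto simp: prob_simplex_def intro: less_imp_le)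
qed

lemma softmax_vec_ln:
  assumes "\<sigma> \<in> prob_simplex" "\<And>i. 0 < \<sigma> $ i"
  shows "softmax (vec_ln \<sigma>) = \<sigma>"
  using assms by (simp add: softmax_def vec_ln_def vec_eq_iff prob_simplexD)

text \<open>Moving \<open>\<theta>\<close> by \<open>n\<close> changes the numerator and the
  normalising sum each by a factor of at most \<open>exp n\<close>, hence the 2 in the exponent. The
  bound is a factor and not a summand, so it stays useful where entries of \<open>softmax\<close>
  tend to 0.\<close>

lemma softmax_le: "softmax \<phi> $ i \<le> exp (2 * norm (\<phi> - \<theta>)) * softmax \<theta> $ i"
proof -
  define n where "n = norm (\<phi> - \<theta>)"
  have d: "\<bar>\<phi> $ j - \<theta> $ j\<bar> \<le> n" for j
    using component_le_norm_cart[of "\<phi> - \<theta>" j] by (simp add: n_def)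
  have up: "exp (\<phi> $ i) \<le> exp n * exp (\<theta> $ i)"
    using d[of i] by (simp flip: exp_add)
  have "exp (- n) * (\<Sum>j\<in>UNIV. exp (\<theta> $ j)) \<le> (\<Sum>j\<in>UNIV. exp (\<phi> $ j))"
    unfolding sum_distrib_left
  proof (intro sum_mono)
    show "exp (- n) * exp (\<theta> $ j) \<le> exp (\<phi> $ j)" for j
      using d[of j] by (simp flip: exp_add)
  qed
  then have "exp (\<phi> $ i) / (\<Sum>j\<in>UNIV. exp (\<phi> $ j))
      \<le> exp n * exp (\<theta> $ i) / (exp (- n) * (\<Sum>j\<in>UNIV. exp (\<theta> $ j)))"
    using up sum_exp_pos[of "\<lambda>j. \<theta> $ j"] by (intro frac_le) auto
  also have "\<dots> = exp (2 * n) * (exp (\<theta> $ i) / (\<Sum>j\<in>UNIV. exp (\<theta> $ j)))"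
  proof -
    have "exp (2 * n) = exp n * exp n" by (simp flip: exp_add)
    then show ?thesis by (simp add: exp_minus field_simps)
  qed
  finally show ?thesis by (simp add: softmax_def n_def)
qed

text \<open>The error is measured relative to the entry itself, which permits division by that entry
  near the boundary of the simplex. The upper side is \<open>softmax_le\<close>; the lower side
  comes from \<open>softmax_le\<close> with the two arguments exchanged.\<close>

lemma softmax_component_diff:
  assumes "norm (\<phi> - \<theta>) \<le> r"
  shows "\<bar>softmax \<phi> $ i - softmax \<theta> $ i\<bar> \<le> (exp (2 * r) - 1) * softmax \<theta> $ i"
proof -
  define e where "e = exp (2 * r)"
  have "0 \<le> r" using assms norm_ge_zero order_trans by blast
  then have e: "1 \<le> e" by (simp add: e_def)
  have *: "exp (2 * norm (\<phi> - \<theta>)) \<le> e" "exp (2 * norm (\<theta> - \<phi>)) \<le> e"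
    using assms by (simp_all add: e_def norm_minus_commute)
  have 1: "softmax \<phi> $ i \<le> e * softmax \<theta> $ i" "softmax \<theta> $ i \<le> e * softmax \<phi> $ i"
    using order_trans[OF softmax_le mult_right_mono[OF *(1)]]
      order_trans[OF softmax_le mult_right_mono[OF *(2)]] softmax_pos less_imp_le by blast+
  \<comment> \<open>The lower side, since \<open>2 - e = 1 - (e - 1)\<close>. For
    \<open>e \<le> 2\<close> it rests on \<open>(2 - e) * e = 1 - (e - 1)\<^sup>2 \<le> 1\<close>;
    for larger \<open>e\<close> the left side is negative.\<close>
  have "(2 - e) * softmax \<theta> $ i \<le> softmax \<phi> $ i"
  proof (cases "e \<le> 2")
    case True
    have "(2 - e) * softmax \<theta> $ i \<le> (2 - e) * (e * softmax \<phi> $ i)"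
      using True 1 by (intro mult_left_mono) auto
    also have "\<dots> = (1 - (e - 1)\<^sup>2) * softmax \<phi> $ i"
      by (simp add: algebra_simps power2_eq_square)
    also have "\<dots> \<le> 1 * softmax \<phi> $ i"
      using softmax_pos[of \<phi> i] by (intro mult_right_mono) auto
    finally show ?thesis by simp
  next
    case False
    then have "(2 - e) * softmax \<theta> $ i \<le> 0"
      using softmax_pos[of \<theta> i] by (simp add: mult_le_0_iff)
    then show ?thesis using softmax_pos[of \<phi> i] by linarith
  qed
  then show ?thesis
    unfolding e_def[symmetric] using 1 by (simp add: abs_le_iff algebra_simps)
qed

text \<open>The relative errors are summed with the entries of \<open>softmax \<theta>\<close> as
  weights, and these add up to 1.\<close>

lemma softmax_dist:
  assumes "norm (\<phi> - \<theta>) \<le> r"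
  shows "norm (softmax \<phi> - softmax \<theta>) \<le> exp (2 * r) - 1"
proof -
  have "norm (softmax \<phi> - softmax \<theta>) \<le> (\<Sum>i\<in>UNIV. \<bar>(softmax \<phi> - softmax \<theta>) $ i\<bar>)"
    by (rule norm_le_l1_cart)
  also have "\<dots> \<le> (\<Sum>i\<in>UNIV. (exp (2 * r) - 1) * softmax \<theta> $ i)"
    using softmax_component_diff[OF assms] by (intro sum_mono) simp
  also have "\<dots> = exp (2 * r) - 1"
    using softmax_in_prob_simplex[of \<theta>] by (simp add: prob_simplexD flip: sum_distrib_left)
  finally show ?thesis .
qed

subsection \<open>The maps on the simplex\<close>

lemma C1_near_simplexD:
  assumes "C1_near_simplex F"
  shows "continuous_on prob_simplex F"
    and "continuous_on prob_simplex (\<lambda>\<sigma>. jacobian F (at \<sigma>))"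
    and "\<And>\<sigma>. \<sigma> \<in> prob_simplex \<Longrightarrow> F differentiable at \<sigma>"
proof -
  obtain U where U: "prob_simplex \<subseteq> U" "\<And>\<sigma>. \<sigma> \<in> U \<Longrightarrow> F differentiable at \<sigma>"
      "continuous_on U (\<lambda>\<sigma>. jacobian F (at \<sigma>))"
    using assms by (auto simp: C1_near_simplex_def C1_on_def)
  show d: "F differentiable at \<sigma>" if "\<sigma> \<in> prob_simplex" for \<sigma> using U that by blast
  show "continuous_on prob_simplex (\<lambda>\<sigma>. jacobian F (at \<sigma>))"
    using U continuous_on_subset by blast
  show "continuous_on prob_simplex F"
    by (intro continuous_at_imp_continuous_on ballI differentiable_imp_continuous_within d)
qed

text \<open>The jacobian is continuous, hence bounded, on the compact simplex, and convexity keeps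
  the segment between two points inside, so the mean value inequality applies.\<close>

lemma C1_near_simplex_Lipschitz:
  fixes F :: "real ^ 'n \<Rightarrow> real ^ 'n"
  assumes "C1_near_simplex F"
  obtains L where "0 \<le> L"
    "\<And>x y. x \<in> prob_simplex \<Longrightarrow> y \<in> prob_simplex \<Longrightarrow> norm (F x - F y) \<le> L * norm (x - y)"
proof -
  have "bounded ((\<lambda>\<sigma>. jacobian F (at \<sigma>)) ` prob_simplex)"
    by (intro compact_imp_bounded compact_continuous_image C1_near_simplexD assms
        compact_prob_simplex)
  then obtain b where b: "0 < b" "\<And>\<sigma>. \<sigma> \<in> prob_simplex \<Longrightarrow> norm (jacobian F (at \<sigma>)) \<le> b"
    by (auto simp: bounded_pos)
  \<comment> \<open>\<open>onorm_le_matrix_component\<close> bounds the operator norm by the number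
    of matrix entries times a bound \<open>b\<close> on their absolute values.\<close>
  define L where "L = real CARD('n) * real CARD('n) * b"
  show ?thesis
  proof
    show "0 \<le> L" using b by (simp add: L_def)
    fix x y :: "real ^ 'n"
    assume xy: "x \<in> prob_simplex" "y \<in> prob_simplex"
    show "norm (F x - F y) \<le> L * norm (x - y)"
    proof (rule differentiable_bound[OF convex_prob_simplex _ _ xy])
      fix \<sigma> :: "real ^ 'n"
      assume \<sigma>: "\<sigma> \<in> prob_simplex"
      show "(F has_derivative (\<lambda>h. jacobian F (at \<sigma>) *v h)) (at \<sigma> within prob_simplex)"
        using C1_near_simplexD(3)[OF assms \<sigma>] jacobian_works has_derivative_at_withinI by blast
      have "\<bar>jacobian F (at \<sigma>) $ i $ j\<bar> \<le> b" for i j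
        using b(2)[OF \<sigma>] component_le_norm_cart[of "jacobian F (at \<sigma>) $ i" j]
          Finite_Cartesian_Product.norm_nth_le[of "jacobian F (at \<sigma>)" i] by linarith
      then show "onorm (\<lambda>h. jacobian F (at \<sigma>) *v h) \<le> L"
        unfolding L_def by (rule onorm_le_matrix_component)
    qed
  qed
qed

lemma outer_mult_vec: "outer x y *v z = (y \<bullet> z) *\<^sub>R x"
  by (simp add: outer_def matrix_vector_mult_def inner_vec_def vec_eq_iff sum_distrib_left
      mult_ac)

lemma diag_mult_vec: "diag v *v x = v * x"
  by (simp add: diag_def matrix_vector_mult_def vec_eq_iff if_distrib[of "\<lambda>x. x * _"] cong: if_cong)

lemma projection_mult_vec: "(mat 1 - outer x y) *v z = z - (y \<bullet> z) *\<^sub>R x"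
  by (simp add: matrix_vector_mult_diff_rdistrib outer_mult_vec)

lemma G_eq: "G F \<sigma> \<mu> = \<sigma> * F \<sigma> - \<mu> - (\<sigma> \<bullet> F \<sigma> - sum_entries \<mu>) *\<^sub>R \<sigma>"
proof -
  have "1 \<bullet> (\<sigma> * F \<sigma>) = \<sigma> \<bullet> F \<sigma>" by (simp add: inner_vec_def)
  then show ?thesis
    by (simp add: G_def projection_mult_vec inner_diff_right sum_entries_eq_inner inner_commute)
qed

text \<open>The factor \<open>\<sigma> $ i\<close> cancels from every term but \<open>\<mu>\<close>,
  so the quotient \<open>\<mu> $ i / \<sigma> $ i\<close> is the only term that needs care near the
  boundary of the simplex.\<close>

lemma G_tilde_nth:
  assumes "0 < \<sigma> $ i"
  shows "G_tilde F \<sigma> \<mu> $ i = F \<sigma> $ i - \<mu> $ i / \<sigma> $ i - (\<sigma> \<bullet> F \<sigma> - sum_entries \<mu>)"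
  using assms by (simp add: G_tilde_def vec_div_def G_eq field_simps)

text \<open>Solves \<open>G = 0\<close> for \<open>\<mu>\<close>. This is the description of the
  bundle by \<open>\<sigma> * F \<sigma> + v *\<^sub>R \<sigma>\<close>, with
  \<open>v = sum_entries \<mu> - \<sigma> \<bullet> F \<sigma>\<close>.\<close>

lemma fp_bundle_mu_eq:
  assumes "(\<sigma>, \<mu>) \<in> fp_bundle F"
  shows "\<mu> = \<sigma> * F \<sigma> - (\<sigma> \<bullet> F \<sigma> - sum_entries \<mu>) *\<^sub>R \<sigma>"
  using assms by (simp add: fp_bundle_def G_eq algebra_simps)

text \<open>Serves to keep limits of path points on the bundle.\<close>

lemma closed_fp_bundle:
  assumes "C1_near_simplex F"
  shows "closed (fp_bundle F)"
proof -
  have "continuous_on (prob_simplex \<times> UNIV) (\<lambda>p. G F (fst p) (snd p))"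
    unfolding G_eq
    by (intro continuous_intros continuous_on_compose2[OF C1_near_simplexD(1)[OF assms]]) auto
  then have "closed {p \<in> prob_simplex \<times> UNIV. G F (fst p) (snd p) = 0}"
    by (intro continuous_closed_preimage_constant closed_Times)
      (auto simp: compact_imp_closed compact_prob_simplex)
  also have "{p \<in> prob_simplex \<times> UNIV. G F (fst p) (snd p) = 0} = fp_bundle F"
    by (auto simp: fp_bundle_def)
  finally show ?thesis .
qed

subsection \<open>The system matrix\<close>

text \<open>The matrix product is evaluated from right to left: \<open>y\<close> is the projected
  vector and \<open>w\<close> its image under the middle factor. This form makes both the continuity
  and the inner product with \<open>\<sigma>\<close> easy to read off.\<close>

lemma jacobian_J_mult_vec:
  fixes F :: "real ^ 'n \<Rightarrow> real ^ 'n" and x :: "real ^ 'n"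
  defines "y \<sigma> \<equiv> x - (\<sigma> \<bullet> x) *\<^sub>R 1"
  defines "w \<sigma> \<equiv> jacobian F (at \<sigma>) *v (\<sigma> * y \<sigma>) + (F \<sigma> - (\<sigma> \<bullet> F \<sigma>) *\<^sub>R 1) * y \<sigma>"
  shows "jacobian_J F k \<sigma> *v x = w \<sigma> - (\<sigma> \<bullet> w \<sigma>) *\<^sub>R 1 + (k * (\<sigma> \<bullet> x)) *\<^sub>R 1"
  by (simp add: jacobian_J_def matrix_vector_mult_add_rdistrib projection_mult_vec outer_mult_vec
      diag_mult_vec y_def w_def flip: matrix_vector_mul_assoc scaleR_matrix_vector_assoc)

text \<open>Left multiplication by \<open>\<sigma>\<close> annihilates
  \<open>mat 1 - outer 1 \<sigma>\<close>, because the entries of \<open>\<sigma>\<close> sum to 1;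
  only the rank-one term with \<open>k\<close> survives.\<close>

lemma inner_jacobian_J:
  assumes "\<sigma> \<in> prob_simplex"
  shows "\<sigma> \<bullet> (jacobian_J F k \<sigma> *v x) = k * (\<sigma> \<bullet> x)"
  using prob_simplexD(3)[OF assms] by (simp add: jacobian_J_mult_vec inner_add_right inner_diff_right)

lemma system_matrix_mult_vec:
  "system_matrix F k \<sigma> \<mu> *v x = jacobian_J F k \<sigma> *v x + sum_entries \<mu> *\<^sub>R x"
  by (simp add: system_matrix_def matrix_vector_mult_add_rdistrib flip: scaleR_matrix_vector_assoc)

text \<open>Continuity is joint in the point and the vector, so that the pair can range over a
  compact product with the unit sphere.\<close>

lemma continuous_on_system_matrix:
  assumes "C1_near_simplex F"
  shows "continuous_on ((prob_simplex \<times> UNIV) \<times> UNIV)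
    (\<lambda>q. system_matrix F k (fst (fst q)) (snd (fst q)) *v snd q)"
  unfolding system_matrix_mult_vec jacobian_J_mult_vec
  by (intro continuous_intros continuous_on_compose2[OF C1_near_simplexD(1)[OF assms]]
      continuous_on_compose2[OF C1_near_simplexD(2)[OF assms]]) auto

lemma system_matrix_kernel_on_bundle:
  assumes E: "(\<sigma>, \<mu>) \<in> fp_bundle F"
    and S: "(\<sigma>, \<mu>) \<notin> singular_manifold F k"
    and k: "k + sum_entries \<mu> \<noteq> 0"
    and x: "system_matrix F k \<sigma> \<mu> *v x = 0"
  shows "x = 0"
proof (rule ccontr)
  assume "x \<noteq> 0"
  have \<sigma>: "\<sigma> \<in> prob_simplex" using E by (simp add: fp_bundle_def)
  have J: "jacobian_J F k \<sigma> *v x = (- sum_entries \<mu>) *\<^sub>R x"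
    using x by (simp add: system_matrix_mult_vec eq_neg_iff_add_eq_0)
  then have "k * (\<sigma> \<bullet> x) = - sum_entries \<mu> * (\<sigma> \<bullet> x)"
    using inner_jacobian_J[OF \<sigma>, of F k x] by simp
  then have "(k + sum_entries \<mu>) * (\<sigma> \<bullet> x) = 0" by (simp add: algebra_simps)
  \<comment> \<open>As \<open>k + sum_entries \<mu>\<close> is nonzero, \<open>x\<close> is
    orthogonal to \<open>\<sigma>\<close> and so counts as an eigenvector of the
    restriction.\<close>
  then have "- sum_entries \<mu> \<in> perp_eigenvalues F k \<sigma>"
    using J k \<open>x \<noteq> 0\<close> by (auto simp: perp_eigenvalues_def)
  \<comment> \<open>On the bundle \<open>\<mu>\<close> is determined by \<open>\<sigma>\<close> and
    its entry sum; it has the shape required by the singular manifold with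
    \<open>l = - sum_entries \<mu>\<close>.\<close>
  moreover have "\<mu> = mu_tilde F \<sigma> - (- sum_entries \<mu>) *\<^sub>R \<sigma>"
  proof -
    have "1 \<bullet> (\<sigma> * F \<sigma>) = \<sigma> \<bullet> F \<sigma>" by (simp add: inner_vec_def)
    then have "mu_tilde F \<sigma> = \<sigma> * F \<sigma> - (\<sigma> \<bullet> F \<sigma>) *\<^sub>R \<sigma>"
      by (simp add: mu_tilde_def projection_mult_vec)
    also have "\<dots> = \<mu> - sum_entries \<mu> *\<^sub>R \<sigma>"
      using fp_bundle_mu_eq[OF E] by (simp add: algebra_simps)
    finally show ?thesis by simp
  qed
  ultimately show False using S \<sigma> unfolding singular_manifold_def by blast
qed

text \<open>The points with a unit kernel vector, paired with that vector, form a closed set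
  \<open>W\<close> disjoint from the compact product of \<open>K\<close> and the unit sphere. The
  radius \<open>e\<close> bounds the distance of the two sets from below.\<close>

lemma system_matrix_kernel_near_compact:
  fixes F :: "real ^ 'n \<Rightarrow> real ^ 'n"
  assumes F: "C1_near_simplex F"
    and K: "compact K"
    and ker: "\<And>\<sigma> \<mu> x. (\<sigma>, \<mu>) \<in> K \<Longrightarrow> system_matrix F k \<sigma> \<mu> *v x = 0 \<Longrightarrow> x = 0"
  obtains e where "0 < e"
    "\<And>\<sigma> \<mu> x p. p \<in> K \<Longrightarrow> dist p (\<sigma>, \<mu>) < e \<Longrightarrow> \<sigma> \<in> prob_simplex \<Longrightarrow>
       system_matrix F k \<sigma> \<mu> *v x = 0 \<Longrightarrow> x = 0"
proof -
  define W where "W = {q \<in> (prob_simplex \<times> UNIV) \<times> sphere (0 :: real ^ 'n) 1.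
    system_matrix F k (fst (fst q)) (snd (fst q)) *v snd q = 0}"
  have "closed W" unfolding W_def
    by (intro continuous_closed_preimage_constant closed_Times
        continuous_on_subset[OF continuous_on_system_matrix[OF F]])
      (auto simp: compact_imp_closed compact_prob_simplex)
  moreover have "compact (K \<times> sphere (0 :: real ^ 'n) 1)" by (intro compact_Times K compact_sphere)
  moreover have "(K \<times> sphere (0 :: real ^ 'n) 1) \<inter> W = {}"
  proof -
    have "x \<noteq> 0" if "norm x = 1" for x :: "real ^ 'n" using that by auto
    then show ?thesis using ker by (fastforce simp: W_def)
  qed
  ultimately obtain e where e: "0 < e" "\<forall>q\<in>K \<times> sphere 0 1. \<forall>r\<in>W. e \<le> dist q r"
    using separate_compact_closed by blast
  show ?thesis
  proof
    show "0 < e" by fact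
    fix \<sigma> \<mu> x p
    assume p: "p \<in> K" "dist p (\<sigma>, \<mu>) < e" "\<sigma> \<in> prob_simplex" "system_matrix F k \<sigma> \<mu> *v x = 0"
    show "x = 0"
    proof (rule ccontr)
      assume "x \<noteq> 0"
      define u where "u = (1 / norm x) *\<^sub>R x"
      have "norm u = 1" using \<open>x \<noteq> 0\<close> by (simp add: u_def)
      moreover have "system_matrix F k \<sigma> \<mu> *v u = 0"
        using p by (simp add: u_def matrix_vector_mult_scaleR)
      ultimately have "((\<sigma>, \<mu>), u) \<in> W" using p by (simp add: W_def)
      \<comment> \<open>Both pairs carry the same vector \<open>u\<close>, so their distance is that
        of \<open>p\<close> and \<open>(\<sigma>, \<mu>)\<close>.\<close>
      then have "e \<le> dist (p, u) ((\<sigma>, \<mu>), u)" using e p \<open>norm u = 1\<close> by auto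
      then show False using p by (simp add: dist_Pair_Pair)
    qed
  qed
qed

text \<open>The constant is the minimum of the norm of the image over \<open>N\<close> times the
  unit sphere. It is attained by compactness, positive because the kernels are trivial, and extends
  to all vectors by homogeneity.\<close>

lemma system_matrix_uniform_bound:
  fixes F :: "real ^ 'n \<Rightarrow> real ^ 'n"
  assumes F: "C1_near_simplex F"
    and N: "compact N" "N \<subseteq> prob_simplex \<times> UNIV"
    and ker: "\<And>\<sigma> \<mu> x. (\<sigma>, \<mu>) \<in> N \<Longrightarrow> system_matrix F k \<sigma> \<mu> *v x = 0 \<Longrightarrow> x = 0"
  obtains c where "0 < c"
    "\<And>\<sigma> \<mu> x. (\<sigma>, \<mu>) \<in> N \<Longrightarrow> c * norm x \<le> norm (system_matrix F k \<sigma> \<mu> *v x)"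
proof (cases "N = {}")
  case True
  then show ?thesis using that[of 1] by auto
next
  case False
  define f where
    "f = (\<lambda>q. norm (system_matrix F k (fst (fst q)) (snd (fst q)) *v (snd q :: real ^ 'n)))"
  have "continuous_on (N \<times> sphere 0 1) f"
    unfolding f_def using N
    by (intro continuous_on_norm continuous_on_subset[OF continuous_on_system_matrix[OF F]]) auto
  moreover have "compact (N \<times> sphere (0 :: real ^ 'n) 1)" by (intro compact_Times N compact_sphere)
  \<comment> \<open>An arbitrary coordinate vector shows that the sphere is nonempty, as the
    existence of a minimum requires.\<close>
  moreover have "axis undefined 1 \<in> sphere (0 :: real ^ 'n) 1" by simp
  then have "N \<times> sphere (0 :: real ^ 'n) 1 \<noteq> {}" using False by blast
  ultimately obtain q where q: "q \<in> N \<times> sphere 0 1" "\<forall>r\<in>N \<times> sphere 0 1. f q \<le> f r"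
    using continuous_attains_inf by blast
  show ?thesis
  proof
    have "snd q \<noteq> 0" "(fst (fst q), snd (fst q)) \<in> N" using q by auto
    then show "0 < f q" using ker[of "fst (fst q)" "snd (fst q)" "snd q"] by (auto simp: f_def)
    fix \<sigma> \<mu> x
    assume p: "(\<sigma>, \<mu>) \<in> N"
    show "f q * norm x \<le> norm (system_matrix F k \<sigma> \<mu> *v x)"
    proof (cases "x = 0")
      case False
      define u where "u = (1 / norm x) *\<^sub>R x"
      have "norm u = 1" and x: "norm x *\<^sub>R u = x" using False by (simp_all add: u_def)
      then have "((\<sigma>, \<mu>), u) \<in> N \<times> sphere 0 1" using p by simp
      then have "f q \<le> norm (system_matrix F k \<sigma> \<mu> *v u)" using q by (fastforce simp: f_def)
      then have "f q * norm x \<le> norm x * norm (system_matrix F k \<sigma> \<mu> *v u)"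
        by (simp add: mult.commute mult_left_mono)
      also have "\<dots> = norm (system_matrix F k \<sigma> \<mu> *v x)"
        using matrix_vector_mult_scaleR[of "system_matrix F k \<sigma> \<mu>" "norm x" u] by (simp add: x)
      finally show ?thesis .
    qed simp
  qed
qed

subsection \<open>Paths and their neighbourhoods\<close>

text \<open>Compactness holds because the path is a finite union of continuous images of closed
  intervals. On each segment \<open>\<mu>\<close> is a multiple of a positive vector, and a positive
  entry sum forces the factor to be positive.\<close>

lemma bundle_pathD:
  assumes "bundle_path F \<Gamma> \<sigma>_end"
  shows "compact \<Gamma>" "\<Gamma> \<subseteq> fp_bundle F"
    "\<And>\<sigma> \<mu> j. (\<sigma>, \<mu>) \<in> \<Gamma> \<Longrightarrow> 0 < sum_entries \<mu> \<Longrightarrow> 0 < \<mu> $ j"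
proof -
  obtain q :: nat and \<gamma> :: "nat \<Rightarrow> real" and \<mu>' :: "nat \<Rightarrow> real ^ 'a" and c where
    i: "\<And>i. i \<in> {1..q} \<Longrightarrow> (\<forall>j. 0 < \<mu>' i $ j) \<and> continuous_on {\<gamma> i..1} (c i) \<and>
          (\<forall>g\<in>{\<gamma> i..1}. (c i g, g *\<^sub>R \<mu>' i) \<in> fp_bundle F)"
    and \<Gamma>: "\<Gamma> = (\<Union>i\<in>{1..q}. (\<lambda>g. (c i g, g *\<^sub>R \<mu>' i)) ` {\<gamma> i..1})"
    using assms unfolding bundle_path_def by blast
  show "compact \<Gamma>" unfolding \<Gamma> using i
    by (intro compact_UN compact_continuous_image continuous_intros) auto
  show "\<Gamma> \<subseteq> fp_bundle F" unfolding \<Gamma> using i by auto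
  fix \<sigma> \<mu> j
  assume "(\<sigma>, \<mu>) \<in> \<Gamma>" and pos: "0 < sum_entries \<mu>"
  then obtain n g where n: "n \<in> {1..q}" "\<mu> = g *\<^sub>R \<mu>' n" unfolding \<Gamma> by blast
  then have "0 < sum_entries (\<mu>' n)" using i unfolding sum_entries_def by (intro sum_pos) auto
  then have "0 < g" using pos n by (simp add: sum_entries_scaleR zero_less_mult_iff)
  then show "0 < \<mu> $ j" using n i by simp
qed

text \<open>By \<open>fp_bundle_mu_eq\<close> the ratio of \<open>\<mu> $ i\<close> to
  \<open>\<sigma> $ i\<close> is a continuous function on the path, and \<open>A\<close> bounds it
  by compactness.\<close>

lemma bundle_path_mu_bounds:
  assumes F: "C1_near_simplex F" and path: "bundle_path F \<Gamma> \<sigma>_end"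
  obtains A where "0 \<le> A"
    "\<And>\<sigma> \<mu> i. (\<sigma>, \<mu>) \<in> \<Gamma> \<Longrightarrow> 0 < sum_entries \<mu> \<Longrightarrow> 0 < \<sigma> $ i \<and> 0 < \<mu> $ i \<and> \<mu> $ i \<le> A * \<sigma> $ i"
proof -
  note \<Gamma> = bundle_pathD[OF path]
  have "compact ((\<lambda>p. F (fst p) $ i - fst p \<bullet> F (fst p) + sum_entries (snd p)) ` \<Gamma>)" for i
    using \<Gamma> by (intro compact_continuous_image continuous_intros
        continuous_on_compose2[OF C1_near_simplexD(1)[OF F]]) (auto simp: fp_bundle_def)
  then have "bounded (\<Union>i. (\<lambda>p. F (fst p) $ i - fst p \<bullet> F (fst p) + sum_entries (snd p)) ` \<Gamma>)"
    by (intro bounded_UN compact_imp_bounded) auto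
  then obtain A where A: "0 < A"
    "\<And>\<sigma> \<mu> i. (\<sigma>, \<mu>) \<in> \<Gamma> \<Longrightarrow> \<bar>F \<sigma> $ i - \<sigma> \<bullet> F \<sigma> + sum_entries \<mu>\<bar> \<le> A"
    unfolding bounded_pos by fastforce
  show ?thesis
  proof
    show "0 \<le> A" using A by simp
    fix \<sigma> \<mu> i
    assume p: "(\<sigma>, \<mu>) \<in> \<Gamma>" and pos: "0 < sum_entries \<mu>"
    have E: "(\<sigma>, \<mu>) \<in> fp_bundle F" using \<Gamma> p by blast
    then have \<sigma>: "0 \<le> \<sigma> $ i" by (simp add: fp_bundle_def prob_simplexD)
    have \<mu>: "0 < \<mu> $ i" using \<Gamma>(3)[OF p pos] .
    have eq: "\<mu> $ i = (F \<sigma> $ i - \<sigma> \<bullet> F \<sigma> + sum_entries \<mu>) * \<sigma> $ i"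
      by (subst fp_bundle_mu_eq[OF E]) (simp add: algebra_simps)
    also have "\<dots> \<le> A * \<sigma> $ i"
      using A(2)[OF p, of i] \<sigma> by (intro mult_right_mono) auto
    finally have "\<mu> $ i \<le> A * \<sigma> $ i" .
    \<comment> \<open>By \<open>eq\<close>, a vanishing entry of \<open>\<sigma>\<close> would make
      the positive entry of \<open>\<mu>\<close> vanish.\<close>
    moreover have "\<sigma> $ i \<noteq> 0" using eq \<mu> by auto
    ultimately show "0 < \<sigma> $ i \<and> 0 < \<mu> $ i \<and> \<mu> $ i \<le> A * \<sigma> $ i" using \<sigma> \<mu> by simp
  qed
qed

text \<open>Where the entry sum is positive the path stays off the boundary of the simplex, so
  \<open>vec_ln\<close> never meets a zero entry.\<close>

lemma softmax_vec_ln_on_path: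
  assumes path: "bundle_path F \<Gamma> \<sigma>_end" and F: "C1_near_simplex F"
    and p: "(\<sigma>, \<mu>) \<in> \<Gamma>" "0 < sum_entries \<mu>"
  shows "softmax (vec_ln \<sigma>) = \<sigma>"
proof (rule softmax_vec_ln)
  show "\<sigma> \<in> prob_simplex" using bundle_pathD(2)[OF path] p by (auto simp: fp_bundle_def)
  show "0 < \<sigma> $ i" for i
    by (rule bundle_path_mu_bounds[OF F path]) (use p in blast)
qed

text \<open>A shift of \<open>\<theta>\<close> by at most \<open>d\<close> costs a factor
  \<open>exp (2 * d)\<close> in the bound along the path. The inequalities avoid division, so they
  pass to the closure, where entries of \<open>\<sigma>\<close> may vanish.\<close>

lemma path_nbhd_bounds:
  fixes F :: "real ^ 'n \<Rightarrow> real ^ 'n"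
  assumes F: "C1_near_simplex F" and path: "bundle_path F \<Gamma> \<sigma>_end" and \<zeta>: "0 \<le> \<zeta>"
  obtains A where "0 \<le> A"
    "\<And>\<sigma> \<mu> i. (\<sigma>, \<mu>) \<in> path_nbhd \<Gamma> d \<zeta> \<Longrightarrow>
       \<sigma> \<in> prob_simplex \<and> 0 \<le> \<mu> $ i \<and> \<mu> $ i \<le> A * \<sigma> $ i"
proof -
  obtain A where A: "0 \<le> A" "\<And>\<sigma> \<mu> i. (\<sigma>, \<mu>) \<in> \<Gamma> \<Longrightarrow> 0 < sum_entries \<mu> \<Longrightarrow>
      0 < \<sigma> $ i \<and> 0 < \<mu> $ i \<and> \<mu> $ i \<le> A * \<sigma> $ i"
    by (rule bundle_path_mu_bounds[OF F path]) blast
  define B where "B = A * exp (2 * d)"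
  define T :: "((real ^ 'n) \<times> (real ^ 'n)) set" where
    "T = (prob_simplex \<times> UNIV) \<inter> {p. \<forall>i. 0 \<le> snd p $ i \<and> snd p $ i \<le> B * fst p $ i}"
  have "closed T" unfolding T_def
    by (intro closed_Int closed_Times closed_Collect_all closed_Collect_conj closed_Collect_le
        continuous_intros) (auto simp: compact_imp_closed compact_prob_simplex)
  moreover have "{(softmax \<theta>, \<mu>) | \<theta> \<mu> \<sigma>\<^sub>\<mu>.
       norm (\<theta> - vec_ln \<sigma>\<^sub>\<mu>) \<le> d \<and> (\<sigma>\<^sub>\<mu>, \<mu>) \<in> \<Gamma> \<and> \<zeta> < sum_entries \<mu>} \<subseteq> T"
  proof clarify
    fix \<theta> \<mu> \<sigma> assume *: "norm (\<theta> - vec_ln \<sigma>) \<le> d" "(\<sigma>, \<mu>) \<in> \<Gamma>" "\<zeta> < sum_entries \<mu>"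
    have a: "0 < \<sigma> $ i" "0 < \<mu> $ i" "\<mu> $ i \<le> A * \<sigma> $ i" for i
      using A(2)[OF *(2), of i] * \<zeta> by auto
    have s: "softmax (vec_ln \<sigma>) = \<sigma>"
      using softmax_vec_ln_on_path[OF path F *(2)] * \<zeta> by simp
    have "\<mu> $ i \<le> B * softmax \<theta> $ i" for i
    proof -
      have "\<sigma> $ i \<le> exp (2 * norm (vec_ln \<sigma> - \<theta>)) * softmax \<theta> $ i"
        using softmax_le[of "vec_ln \<sigma>" i \<theta>] s by simp
      also have "\<dots> \<le> exp (2 * d) * softmax \<theta> $ i"
        using * softmax_pos[of \<theta> i] by (intro mult_right_mono) (auto simp: norm_minus_commute)
      finally have "A * \<sigma> $ i \<le> A * (exp (2 * d) * softmax \<theta> $ i)"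
        using A by (intro mult_left_mono) auto
      then show ?thesis using a(3)[of i] by (simp add: B_def mult.assoc)
    qed
    then show "(softmax \<theta>, \<mu>) \<in> T"
      using a(2) softmax_in_prob_simplex by (auto simp: T_def intro: less_imp_le)
  qed
  ultimately have T: "path_nbhd \<Gamma> d \<zeta> \<subseteq> T" unfolding path_nbhd_def by (intro closure_minimal)
  show ?thesis
  proof
    show "0 \<le> B" using A by (simp add: B_def)
    fix \<sigma> \<mu> i assume "(\<sigma>, \<mu>) \<in> path_nbhd \<Gamma> d \<zeta>"
    then have "(\<sigma>, \<mu>) \<in> T" using T by blast
    then show "\<sigma> \<in> prob_simplex \<and> 0 \<le> \<mu> $ i \<and> \<mu> $ i \<le> B * \<sigma> $ i" by (simp add: T_def)
  qed
qed

lemma compact_path_nbhd: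
  fixes F :: "real ^ 'n \<Rightarrow> real ^ 'n"
  assumes "C1_near_simplex F" and "bundle_path F \<Gamma> \<sigma>_end" and "0 \<le> \<zeta>"
  shows "compact (path_nbhd \<Gamma> d \<zeta>)"
proof -
  obtain A where A: "0 \<le> A"
    "\<And>\<sigma> \<mu> i. (\<sigma>, \<mu>) \<in> path_nbhd \<Gamma> d \<zeta> \<Longrightarrow>
       \<sigma> \<in> prob_simplex \<and> 0 \<le> \<mu> $ i \<and> \<mu> $ i \<le> A * \<sigma> $ i"
    by (rule path_nbhd_bounds[OF assms, of d]) blast
  have "path_nbhd \<Gamma> d \<zeta> \<subseteq> prob_simplex \<times> cball 0 (real CARD('n) * A)"
  proof clarify
    fix \<sigma> \<mu> assume p: "(\<sigma>, \<mu>) \<in> path_nbhd \<Gamma> d \<zeta>"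
    have \<sigma>: "\<sigma> \<in> prob_simplex" using A(2)[OF p] by blast
    have "\<bar>\<mu> $ i\<bar> \<le> A" for i
    proof -
      have "\<bar>\<mu> $ i\<bar> \<le> A * \<sigma> $ i" using A(2)[OF p, of i] by simp
      also have "\<sigma> $ i \<le> 1"
        using component_le_norm_cart[of \<sigma> i] prob_simplexD(4)[OF \<sigma>] by linarith
      then have "A * \<sigma> $ i \<le> A" using A(1) by (simp add: mult_left_le)
      finally show ?thesis .
    qed
    then show "\<sigma> \<in> prob_simplex \<and> \<mu> \<in> cball 0 (real CARD('n) * A)"
      using \<sigma> norm_le_card_bound[of \<mu> A] by simp
  qed
  then have "bounded (path_nbhd \<Gamma> d \<zeta>)"
    by (rule bounded_subset[rotated])
      (intro bounded_Times compact_imp_bounded compact_prob_simplex bounded_cball)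
  then show ?thesis by (simp add: compact_eq_bounded_closed path_nbhd_def)
qed

text \<open>The choice \<open>\<theta> = vec_ln \<sigma>\<close> has distance 0. This transfers
  hypotheses on the neighbourhood to the path.\<close>

lemma path_part_subset_path_nbhd:
  assumes F: "C1_near_simplex F" and path: "bundle_path F \<Gamma> \<sigma>_end" and "0 \<le> \<zeta>" "0 < d"
  shows "closure {p \<in> \<Gamma>. \<zeta> < sum_entries (snd p)} \<subseteq> path_nbhd \<Gamma> d \<zeta>"
  unfolding path_nbhd_def
proof (intro closure_mono, clarify)
  fix \<sigma> \<mu> assume p: "(\<sigma>, \<mu>) \<in> \<Gamma>" "\<zeta> < sum_entries (snd (\<sigma>, \<mu>))"
  have "softmax (vec_ln \<sigma>) = \<sigma>"
    using softmax_vec_ln_on_path[OF path F p(1)] p \<open>0 \<le> \<zeta>\<close> by simp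
  then have "(\<sigma>, \<mu>) = (softmax (vec_ln \<sigma>), \<mu>) \<and> norm (vec_ln \<sigma> - vec_ln \<sigma>) \<le> d
      \<and> (\<sigma>, \<mu>) \<in> \<Gamma> \<and> \<zeta> < sum_entries \<mu>"
    using p \<open>0 < d\<close> by simp
  then show "\<exists>\<theta> \<mu>' \<sigma>\<^sub>\<mu>. (\<sigma>, \<mu>) = (softmax \<theta>, \<mu>') \<and> norm (\<theta> - vec_ln \<sigma>\<^sub>\<mu>) \<le> d
      \<and> (\<sigma>\<^sub>\<mu>, \<mu>') \<in> \<Gamma> \<and> \<zeta> < sum_entries \<mu>'"
    by blast
qed

lemma path_nbhd_near_path:
  assumes F: "C1_near_simplex F" and path: "bundle_path F \<Gamma> \<sigma>_end" and \<zeta>: "0 \<le> \<zeta>"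
    and "exp (2 * d) - 1 < e" and p: "p \<in> path_nbhd \<Gamma> d \<zeta>"
  obtains p' where "p' \<in> \<Gamma>" "\<zeta> < sum_entries (snd p')" "dist p' p < e"
proof -
  \<comment> \<open>The gap in the strict hypothesis absorbs the error of approximating a point of
    the closure.\<close>
  have "0 < e - (exp (2 * d) - 1)" using assms by simp
  with p obtain y where y: "dist y p < e - (exp (2 * d) - 1)"
    "y \<in> {(softmax \<theta>, \<mu>) | \<theta> \<mu> \<sigma>\<^sub>\<mu>.
       norm (\<theta> - vec_ln \<sigma>\<^sub>\<mu>) \<le> d \<and> (\<sigma>\<^sub>\<mu>, \<mu>) \<in> \<Gamma> \<and> \<zeta> < sum_entries \<mu>}"
    unfolding path_nbhd_def closure_approachable by blast
  then obtain \<theta> \<mu> \<sigma> where *: "norm (\<theta> - vec_ln \<sigma>) \<le> d" "(\<sigma>, \<mu>) \<in> \<Gamma>" "\<zeta> < sum_entries \<mu>"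
    "dist (softmax \<theta>, \<mu>) p < e - (exp (2 * d) - 1)"
    by blast
  have "softmax (vec_ln \<sigma>) = \<sigma>"
    using softmax_vec_ln_on_path[OF path F *(2)] * \<zeta> by simp
  then have "dist (\<sigma>, \<mu>) (softmax \<theta>, \<mu>) \<le> exp (2 * d) - 1"
    using softmax_dist[OF *(1)] by (simp add: dist_Pair_Pair dist_commute dist_norm norm_minus_commute)
  then have "dist (\<sigma>, \<mu>) p < e"
    using *(4) dist_triangle[of "(\<sigma>, \<mu>)" p "(softmax \<theta>, \<mu>)"] by linarith
  then show ?thesis using that[of "(\<sigma>, \<mu>)"] * by simp
qed

text \<open>The hypotheses at the one radius \<open>d\<close> enter only through the set
  \<open>K\<close>, which is independent of \<open>d\<close>. Hence \<open>r\<close> works for every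
  radius up to \<open>r\<close>, whether below or above the given one.\<close>

lemma path_nbhd_kernel_small_radius:
  fixes F :: "real ^ 'n \<Rightarrow> real ^ 'n"
  assumes F: "C1_near_simplex F" and path: "bundle_path F \<Gamma> \<sigma>_end" and \<zeta>: "0 \<le> \<zeta>"
    and d: "0 < d"
    and k: "\<forall>(\<sigma>, \<mu>) \<in> path_nbhd \<Gamma> d \<zeta>. k + sum_entries \<mu> \<noteq> 0"
    and S: "path_nbhd \<Gamma> d \<zeta> \<inter> singular_manifold F k = {}"
  obtains r where "0 < r"
    "\<And>d \<sigma> \<mu> x. d \<le> r \<Longrightarrow> (\<sigma>, \<mu>) \<in> path_nbhd \<Gamma> d \<zeta> \<Longrightarrow>
       system_matrix F k \<sigma> \<mu> *v x = 0 \<Longrightarrow> x = 0"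
proof -
  define K where "K = closure {p \<in> \<Gamma>. \<zeta> < sum_entries (snd p)}"
  have "K \<subseteq> path_nbhd \<Gamma> d \<zeta>"
    unfolding K_def by (rule path_part_subset_path_nbhd[OF F path \<zeta> d])
  moreover have "K \<subseteq> fp_bundle F" unfolding K_def
    using bundle_pathD(2)[OF path] by (intro closure_minimal closed_fp_bundle F) auto
  ultimately have ker: "x = 0" if "(\<sigma>, \<mu>) \<in> K" "system_matrix F k \<sigma> \<mu> *v x = 0" for \<sigma> \<mu> x
    using that k S by (intro system_matrix_kernel_on_bundle[of \<sigma> \<mu> F k x]) auto
  have "compact K" unfolding K_def compact_closure
    using compact_imp_bounded[OF bundle_pathD(1)[OF path]] by (rule bounded_subset) auto
  then obtain e where e: "0 < e"
    "\<And>\<sigma> \<mu> x p. p \<in> K \<Longrightarrow> dist p (\<sigma>, \<mu>) < e \<Longrightarrow> \<sigma> \<in> prob_simplex \<Longrightarrow>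
       system_matrix F k \<sigma> \<mu> *v x = 0 \<Longrightarrow> x = 0"
    by (rule system_matrix_kernel_near_compact[OF F, of K k]) (use ker in blast)+
  \<comment> \<open>Solves \<open>exp (2 * r) - 1 = e / 2\<close>, which stays strictly below
    \<open>e\<close> as \<open>path_nbhd_near_path\<close> demands.\<close>
  define r where "r = ln (1 + e / 2) / 2"
  show ?thesis
  proof
    show "0 < r" using e by (simp add: r_def)
    fix d \<sigma> \<mu> x
    assume *: "d \<le> r" "(\<sigma>, \<mu>) \<in> path_nbhd \<Gamma> d \<zeta>" "system_matrix F k \<sigma> \<mu> *v x = 0"
    have "exp (2 * d) \<le> exp (2 * r)" using * by simp
    also have "\<dots> = 1 + e / 2" using e by (simp add: r_def)
    finally have "exp (2 * d) - 1 < e" using e by linarith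
    then obtain p where "p \<in> \<Gamma>" "\<zeta> < sum_entries (snd p)" "dist p (\<sigma>, \<mu>) < e"
      using path_nbhd_near_path[OF F path \<zeta> _ *(2)] by blast
    moreover from this have "p \<in> K" unfolding K_def by (intro subsetD[OF closure_subset]) auto
    moreover have "\<sigma> \<in> prob_simplex"
      by (rule path_nbhd_bounds[OF F path \<zeta>]) (use * in blast)
    ultimately show "x = 0" using e(2) * by blast
  qed
qed

subsection \<open>One step\<close>

text \<open>Entry \<open>i\<close> of the right-hand side is \<open>\<eta>\<close> times the
  difference of \<open>sum_entries \<mu>\<close> and \<open>\<mu> $ i / \<sigma> $ i\<close>. Both
  numbers lie between 0 and \<open>A\<close>, so the difference is at most \<open>A\<close> in
  absolute value; the constant \<open>c\<close> carries this over to the solution.\<close>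

lemma path_step_dtheta_bound:
  fixes F :: "real ^ 'n \<Rightarrow> real ^ 'n"
  assumes step: "path_step F k \<eta> \<theta> \<mu> \<theta>' \<mu>'"
    and "0 < \<eta>" "0 \<le> A"
    and \<mu>: "\<And>i. 0 \<le> \<mu> $ i" "\<And>i. \<mu> $ i \<le> A * softmax \<theta> $ i"
    and c: "0 < c" "\<And>x. c * norm x \<le> norm (system_matrix F k (softmax \<theta>) \<mu> *v x)"
  shows "norm (\<theta>' - \<theta>) \<le> real CARD('n) * A / c * \<eta>"
proof -
  define \<sigma> where "\<sigma> = softmax \<theta>"
  have \<sigma>: "0 < \<sigma> $ i" for i by (simp add: \<sigma>_def softmax_pos)
  define b where "b = (mat 1 - outer 1 \<sigma>) *v vec_div (- \<eta> *\<^sub>R \<mu>) \<sigma>"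
  have S: "0 \<le> sum_entries \<mu>" "sum_entries \<mu> \<le> A"
    using sum_entries_bounds[OF softmax_in_prob_simplex \<mu>] by auto
  have "\<sigma> \<bullet> vec_div (- \<eta> *\<^sub>R \<mu>) \<sigma> = - \<eta> * sum_entries \<mu>"
    using \<sigma> by (simp add: inner_vec_def vec_div_def sum_entries_def sum_distrib_left less_imp_neq[THEN not_sym]
        sum_negf)
  then have "b $ i = \<eta> * (sum_entries \<mu> - \<mu> $ i / \<sigma> $ i)" for i
    unfolding b_def projection_mult_vec by (simp add: vec_div_def algebra_simps)
  moreover have "\<bar>sum_entries \<mu> - \<mu> $ i / \<sigma> $ i\<bar> \<le> A" for i
  proof -
    have "0 \<le> \<mu> $ i / \<sigma> $ i" "\<mu> $ i / \<sigma> $ i \<le> A"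
      using \<mu>[of i] \<sigma>[of i] by (simp_all add: pos_divide_le_eq flip: \<sigma>_def)
    then show ?thesis using S by linarith
  qed
  ultimately have "\<bar>b $ i\<bar> \<le> \<eta> * A" for i
    using \<open>0 < \<eta>\<close> by (simp add: abs_mult mult_left_mono)
  then have "norm b \<le> real CARD('n) * (\<eta> * A)" by (rule norm_le_card_bound)
  moreover have "system_matrix F k \<sigma> \<mu> *v (\<theta>' - \<theta>) = b"
    using step by (auto simp: path_step_def b_def \<sigma>_def)
  then have "c * norm (\<theta>' - \<theta>) \<le> norm b" using c(2)[of "\<theta>' - \<theta>"] by (simp add: \<sigma>_def)
  ultimately show ?thesis using c(1) by (simp add: field_simps)
qed

text \<open>By \<open>G_tilde_nth\<close> each entry changes by four differences. Those of
  \<open>F\<close> and of \<open>\<sigma> \<bullet> F \<sigma>\<close> contribute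
  \<open>2 * L * R + B * R\<close>; those of the quotient and of the entry sum contribute
  \<open>A * (2 * R + 1)\<close> and \<open>A\<close>.\<close>

lemma G_tilde_increment_bound:
  fixes F :: "real ^ 'n \<Rightarrow> real ^ 'n"
  assumes L: "0 \<le> L"
      "\<And>x y. x \<in> prob_simplex \<Longrightarrow> y \<in> prob_simplex \<Longrightarrow> norm (F x - F y) \<le> L * norm (x - y)"
    and B: "\<And>x. x \<in> prob_simplex \<Longrightarrow> norm (F x) \<le> B"
    and A: "0 \<le> A" "\<And>i. 0 \<le> \<mu> $ i" "\<And>i. \<mu> $ i \<le> A * softmax \<theta> $ i"
    and D: "0 \<le> D" "norm (\<theta>' - \<theta>) \<le> D * \<eta>"
    and \<eta>: "0 < \<eta>" "\<eta> < 1"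
  defines "R \<equiv> 2 * D * exp (2 * D)"
  shows "norm (G_tilde F (softmax \<theta>') ((1 - \<eta>) *\<^sub>R \<mu>) - G_tilde F (softmax \<theta>) \<mu>)
    \<le> real CARD('n) * (2 * L * R + B * R + A * (2 * R + 2)) * \<eta>"
proof -
  define \<sigma> \<sigma>' \<epsilon> where "\<sigma> = softmax \<theta>" and "\<sigma>' = softmax \<theta>'" and "\<epsilon> = exp (2 * (D * \<eta>)) - 1"
  have \<sigma>: "\<sigma> \<in> prob_simplex" "\<sigma>' \<in> prob_simplex" "0 < \<sigma> $ i" "0 < \<sigma>' $ i" for i
    by (simp_all add: \<sigma>_def \<sigma>'_def softmax_pos softmax_in_prob_simplex)
  have B0: "0 \<le> B" using B[OF \<sigma>(1)] norm_ge_zero order_trans by blast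
  have R0: "0 \<le> R" using D by (simp add: R_def)
  have \<epsilon>0: "0 \<le> \<epsilon>" using D \<eta> by (simp add: \<epsilon>_def)
  have \<epsilon>: "\<epsilon> \<le> R * \<eta>"
  proof -
    \<comment> \<open>Makes the exponential error linear in \<open>\<eta>\<close>; the remaining
      exponential is bounded by its value at \<open>\<eta> = 1\<close>, which explains
      \<open>R\<close>.\<close>
    have "\<epsilon> \<le> 2 * (D * \<eta>) * exp (2 * (D * \<eta>))" unfolding \<epsilon>_def by (rule exp_minus_1_le)
    also have "\<dots> \<le> 2 * (D * \<eta>) * exp (2 * D)"
      using D \<eta> by (intro mult_left_mono) (auto simp: mult_left_le)
    finally show ?thesis by (simp add: R_def mult_ac)
  qed
  have d\<sigma>: "norm (\<sigma>' - \<sigma>) \<le> R * \<eta>"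
    using softmax_dist[OF D(2)] \<epsilon> by (simp add: \<sigma>_def \<sigma>'_def \<epsilon>_def)
  have dF: "norm (F \<sigma>' - F \<sigma>) \<le> L * (R * \<eta>)"
    using order_trans[OF L(2)[OF \<sigma>(2,1)] mult_left_mono[OF d\<sigma> L(1)]] .
  have dinner: "\<bar>\<sigma>' \<bullet> F \<sigma>' - \<sigma> \<bullet> F \<sigma>\<bar> \<le> B * R * \<eta> + L * R * \<eta>"
  proof -
    have "\<sigma>' \<bullet> F \<sigma>' - \<sigma> \<bullet> F \<sigma> = (\<sigma>' - \<sigma>) \<bullet> F \<sigma>' + \<sigma> \<bullet> (F \<sigma>' - F \<sigma>)"
      by (simp add: inner_diff_left inner_diff_right)
    moreover have "\<bar>(\<sigma>' - \<sigma>) \<bullet> F \<sigma>'\<bar> \<le> R * \<eta> * B"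
      using R0 \<eta> by (intro order_trans[OF Cauchy_Schwarz_ineq2] mult_mono d\<sigma> B \<sigma>) auto
    moreover have "\<bar>\<sigma> \<bullet> (F \<sigma>' - F \<sigma>)\<bar> \<le> 1 * (L * (R * \<eta>))"
      by (intro order_trans[OF Cauchy_Schwarz_ineq2] mult_mono dF prob_simplexD(4) \<sigma>) auto
    ultimately show ?thesis by (simp add: mult_ac)
  qed
  have S: "0 \<le> sum_entries \<mu>" "sum_entries \<mu> \<le> A"
    using sum_entries_bounds[OF softmax_in_prob_simplex A(2,3)] by auto
  have dquot: "\<bar>(1 - \<eta>) * \<mu> $ i / \<sigma>' $ i - \<mu> $ i / \<sigma> $ i\<bar> \<le> A * (2 * R + 1) * \<eta>" for i
  proof -
    \<comment> \<open>The new quotient is \<open>(1 - \<eta>) * a * \<rho>\<close>. The old quotient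
      \<open>a\<close> is bounded and \<open>\<rho>\<close> is close to 1, so no lower bound on the
      entries of \<open>\<sigma>\<close> enters.\<close>
    define a \<rho> where "a = \<mu> $ i / \<sigma> $ i" and "\<rho> = \<sigma> $ i / \<sigma>' $ i"
    have a: "0 \<le> a" "a \<le> A"
      using A(2,3)[of i] \<sigma>(3)[of i] by (simp_all add: a_def pos_divide_le_eq flip: \<sigma>_def)
    \<comment> \<open>The relative estimate is used with \<open>\<theta>\<close> and
      \<open>\<theta>'\<close> exchanged, because the denominator of \<open>\<rho>\<close> is the
      new entry.\<close>
    have "\<bar>\<sigma> $ i - \<sigma>' $ i\<bar> \<le> \<epsilon> * \<sigma>' $ i"
      unfolding \<sigma>_def \<sigma>'_def \<epsilon>_def using D(2)
      by (intro softmax_component_diff) (simp add: norm_minus_commute)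
    then have \<rho>: "\<bar>\<rho> - 1\<bar> \<le> \<epsilon>"
      using \<sigma>(4)[of i] by (simp add: \<rho>_def abs_le_iff field_simps)
    have eq: "(1 - \<eta>) * \<mu> $ i / \<sigma>' $ i - \<mu> $ i / \<sigma> $ i = a * ((1 - \<eta>) * (\<rho> - 1) - \<eta>)"
      using \<sigma>(3,4)[of i] by (simp add: a_def \<rho>_def field_simps)
    have "\<bar>(1 - \<eta>) * (\<rho> - 1) - \<eta>\<bar> \<le> \<epsilon> + \<eta>"
    proof -
      have "\<bar>(1 - \<eta>) * (\<rho> - 1)\<bar> \<le> 1 * \<epsilon>"
        unfolding abs_mult using \<eta> \<rho> by (intro mult_mono) auto
      then show ?thesis using \<eta> by linarith
    qed
    moreover have "\<epsilon> + \<eta> \<le> (2 * R + 1) * \<eta>"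
      using \<epsilon> mult_nonneg_nonneg[OF R0 less_imp_le[OF \<eta>(1)]] by (simp add: algebra_simps)
    ultimately have "a * \<bar>(1 - \<eta>) * (\<rho> - 1) - \<eta>\<bar> \<le> A * ((2 * R + 1) * \<eta>)"
      using a A(1) by (intro mult_mono) auto
    then show ?thesis using a by (simp add: eq abs_mult mult.assoc)
  qed
  have "\<bar>(G_tilde F \<sigma>' ((1 - \<eta>) *\<^sub>R \<mu>) - G_tilde F \<sigma> \<mu>) $ i\<bar>
      \<le> (2 * L * R + B * R + A * (2 * R + 2)) * \<eta>" for i
  proof -
    have "\<bar>F \<sigma>' $ i - F \<sigma> $ i\<bar> \<le> L * R * \<eta>"
      using component_le_norm_cart[of "F \<sigma>' - F \<sigma>" i] dF by (simp add: mult.assoc)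
    moreover have "\<bar>sum_entries ((1 - \<eta>) *\<^sub>R \<mu>) - sum_entries \<mu>\<bar> \<le> A * \<eta>"
    proof -
      have "sum_entries ((1 - \<eta>) *\<^sub>R \<mu>) - sum_entries \<mu> = - (\<eta> * sum_entries \<mu>)"
        unfolding sum_entries_scaleR by (simp add: algebra_simps)
      then show ?thesis using S \<eta> by (simp add: mult.commute)
    qed
    moreover have "(G_tilde F \<sigma>' ((1 - \<eta>) *\<^sub>R \<mu>) - G_tilde F \<sigma> \<mu>) $ i
        = (F \<sigma>' $ i - F \<sigma> $ i) - ((1 - \<eta>) * \<mu> $ i / \<sigma>' $ i - \<mu> $ i / \<sigma> $ i)
          - (\<sigma>' \<bullet> F \<sigma>' - \<sigma> \<bullet> F \<sigma>) + (sum_entries ((1 - \<eta>) *\<^sub>R \<mu>) - sum_entries \<mu>)"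
      using \<sigma>(3,4)[of i] by (simp add: G_tilde_nth)
    ultimately have "\<bar>(G_tilde F \<sigma>' ((1 - \<eta>) *\<^sub>R \<mu>) - G_tilde F \<sigma> \<mu>) $ i\<bar>
      \<le> L * R * \<eta> + A * (2 * R + 1) * \<eta> + (B * R * \<eta> + L * R * \<eta>) + A * \<eta>"
      using dquot[of i] dinner by linarith
    then show ?thesis by (simp add: algebra_simps)
  qed
  then have "norm (G_tilde F \<sigma>' ((1 - \<eta>) *\<^sub>R \<mu>) - G_tilde F \<sigma> \<mu>)
      \<le> real CARD('n) * ((2 * L * R + B * R + A * (2 * R + 2)) * \<eta>)"
    by (rule norm_le_card_bound)
  then show ?thesis by (simp add: \<sigma>_def \<sigma>'_def mult.assoc)
qed

section \<open>Uniform constants and the choice of the radius\<close>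

lemma path_step_G_tilde_bound:
  fixes F :: "real ^ 'n \<Rightarrow> real ^ 'n"
  assumes F: "C1_near_simplex F" and path: "bundle_path F \<Gamma> \<sigma>_end" and \<zeta>: "0 \<le> \<zeta>"
    and ker: "\<And>\<sigma> \<mu> x. (\<sigma>, \<mu>) \<in> path_nbhd \<Gamma> d \<zeta> \<Longrightarrow> system_matrix F k \<sigma> \<mu> *v x = 0 \<Longrightarrow> x = 0"
  shows "\<exists>C>0. \<forall>\<theta> \<mu> \<theta>' \<mu>' \<eta>.
     (softmax \<theta>, \<mu>) \<in> path_nbhd \<Gamma> d \<zeta> \<longrightarrow> 0 < \<eta> \<longrightarrow> \<eta> < 1 \<longrightarrow>
     path_step F k \<eta> \<theta> \<mu> \<theta>' \<mu>' \<longrightarrow>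
     norm (G_tilde F (softmax \<theta>') \<mu>' - G_tilde F (softmax \<theta>) \<mu>) \<le> C * \<eta>"
proof -
  obtain A where A: "0 \<le> A"
    "\<And>\<sigma> \<mu> i. (\<sigma>, \<mu>) \<in> path_nbhd \<Gamma> d \<zeta> \<Longrightarrow>
       \<sigma> \<in> prob_simplex \<and> 0 \<le> \<mu> $ i \<and> \<mu> $ i \<le> A * \<sigma> $ i"
    by (rule path_nbhd_bounds[OF F path \<zeta>, of d]) blast
  then have "path_nbhd \<Gamma> d \<zeta> \<subseteq> prob_simplex \<times> UNIV" by auto
  then obtain c where c: "0 < c"
    "\<And>\<sigma> \<mu> x. (\<sigma>, \<mu>) \<in> path_nbhd \<Gamma> d \<zeta> \<Longrightarrow> c * norm x \<le> norm (system_matrix F k \<sigma> \<mu> *v x)"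
    by (rule system_matrix_uniform_bound[OF F compact_path_nbhd[OF F path \<zeta>], of d k])
      (use ker in blast)+
  obtain L where L: "0 \<le> L"
    "\<And>x y. x \<in> prob_simplex \<Longrightarrow> y \<in> prob_simplex \<Longrightarrow> norm (F x - F y) \<le> L * norm (x - y)"
    using C1_near_simplex_Lipschitz[OF F] by blast
  have "bounded (F ` prob_simplex)"
    by (intro compact_imp_bounded compact_continuous_image C1_near_simplexD F compact_prob_simplex)
  then obtain B where B: "0 < B" "\<And>x. x \<in> prob_simplex \<Longrightarrow> norm (F x) \<le> B"
    by (auto simp: bounded_pos)
  define D where "D = real CARD('n) * A / c"
  define R where "R = 2 * D * exp (2 * D)"
  define C where "C = real CARD('n) * (2 * L * R + B * R + A * (2 * R + 2))"
  have D: "0 \<le> D" using A c by (simp add: D_def)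
  then have "0 \<le> C" using A L B by (simp add: C_def R_def)
  \<comment> \<open>\<open>C\<close> is only known to be nonnegative; \<open>C + 1\<close> is a
    positive constant.\<close>
  have bound: "norm (G_tilde F (softmax \<theta>') \<mu>' - G_tilde F (softmax \<theta>) \<mu>) \<le> (C + 1) * \<eta>"
    if p: "(softmax \<theta>, \<mu>) \<in> path_nbhd \<Gamma> d \<zeta>" and \<eta>: "0 < \<eta>" "\<eta> < 1"
      and step: "path_step F k \<eta> \<theta> \<mu> \<theta>' \<mu>'" for \<theta> \<mu> \<theta>' \<mu>' \<eta>
  proof -
    have \<mu>: "0 \<le> \<mu> $ i" "\<mu> $ i \<le> A * softmax \<theta> $ i" for i using A(2)[OF p] by auto
    have "norm (\<theta>' - \<theta>) \<le> D * \<eta>"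
      unfolding D_def using path_step_dtheta_bound[OF step \<eta>(1) A(1) \<mu> c(1) c(2)[OF p]] .
    from G_tilde_increment_bound[where F = F, OF L B(2) A(1) \<mu> D this \<eta>]
    have "norm (G_tilde F (softmax \<theta>') ((1 - \<eta>) *\<^sub>R \<mu>) - G_tilde F (softmax \<theta>) \<mu>) \<le> C * \<eta>"
      unfolding C_def R_def .
    moreover have "\<mu>' = (1 - \<eta>) *\<^sub>R \<mu>" using step by (simp add: path_step_def)
    ultimately show ?thesis using \<eta> by (simp add: distrib_right)
  qed
  show ?thesis using bound \<open>0 \<le> C\<close> by (intro exI[of _ "C + 1"]) auto
qed

text \<open>Everything reduces to trivial kernels of the system matrix on the neighbourhood. On the
  bundle these follow from avoiding the singular manifold; off the bundle, from a small radius or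
  from \<open>regular_off_bundle\<close>.\<close>

theorem proposition13:
  fixes F :: "real ^ 'n \<Rightarrow> real ^ 'n"
    and \<Gamma> :: "((real ^ 'n) \<times> (real ^ 'n)) set"
    and \<sigma>_end :: "real ^ 'n"
    and \<zeta> k :: real
  assumes F_C1: "C1_near_simplex F"
    and path: "bundle_path F \<Gamma> \<sigma>_end"
    and k_nonzero: "k \<noteq> 0"
    and path_regular: "\<Gamma> \<inter> singular_manifold F k \<subseteq> {(\<sigma>_end, 0)}"
    and zeta_nonneg: "0 \<le> \<zeta>"
    and zeta_nonzero: "\<not> invertible (jacobian_J F k \<sigma>_end) \<Longrightarrow> \<zeta> \<noteq> 0"
  shows "\<exists>d\<^sub>0>0. \<forall>d>0.
    (\<forall>(\<sigma>, \<mu>) \<in> path_nbhd \<Gamma> d \<zeta>. k + sum_entries \<mu> \<noteq> 0) \<longrightarrow>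
    path_nbhd \<Gamma> d \<zeta> \<inter> singular_manifold F k = {} \<longrightarrow>
    C1_on (fst ` path_nbhd \<Gamma> d \<zeta>) F \<longrightarrow>
    (d \<le> d\<^sub>0 \<or> regular_off_bundle F k (path_nbhd \<Gamma> d \<zeta>)) \<longrightarrow>
    (\<exists>C\<^sub>2>0. \<forall>\<theta> \<mu> \<theta>' \<mu>' \<eta>.
       (softmax \<theta>, \<mu>) \<in> path_nbhd \<Gamma> d \<zeta> \<longrightarrow> 0 < \<eta> \<longrightarrow> \<eta> < 1 \<longrightarrow>
       path_step F k \<eta> \<theta> \<mu> \<theta>' \<mu>' \<longrightarrow>
       norm (G_tilde F (softmax \<theta>') \<mu>' - G_tilde F (softmax \<theta>) \<mu>) \<le> C\<^sub>2 * \<eta>)"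
proof -
  let ?good = "\<lambda>d. (\<forall>(\<sigma>, \<mu>) \<in> path_nbhd \<Gamma> d \<zeta>. k + sum_entries \<mu> \<noteq> 0) \<and>
    path_nbhd \<Gamma> d \<zeta> \<inter> singular_manifold F k = {}"
  obtain r where r: "0 < r"
    "\<And>d \<sigma> \<mu> x. 0 < d \<Longrightarrow> ?good d \<Longrightarrow> d \<le> r \<Longrightarrow> (\<sigma>, \<mu>) \<in> path_nbhd \<Gamma> d \<zeta> \<Longrightarrow>
       system_matrix F k \<sigma> \<mu> *v x = 0 \<Longrightarrow> x = 0"
  \<comment> \<open>The threshold has to be fixed before \<open>d\<close>. Any good radius yields
    one that serves all radii up to \<open>r\<close>; if no radius is good the claim is vacuous and
    1 is a default.\<close>
  proof (cases "\<exists>d>0. ?good d")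
    case True
    then obtain d where d: "0 < d" "?good d" by blast
    from path_nbhd_kernel_small_radius[OF F_C1 path zeta_nonneg d(1) conjunct1[OF d(2)] conjunct2[OF d(2)]]
    obtain r where "0 < r" "\<And>d \<sigma> \<mu> x. d \<le> r \<Longrightarrow> (\<sigma>, \<mu>) \<in> path_nbhd \<Gamma> d \<zeta> \<Longrightarrow>
        system_matrix F k \<sigma> \<mu> *v x = 0 \<Longrightarrow> x = 0" by blast
    then show ?thesis using that[of r] by blast
  next
    case False
    then show ?thesis using that[of 1] by (metis zero_less_one)
  qed
  show ?thesis
  proof (rule exI[of _ r], intro conjI allI impI r(1))
    fix d :: real
    assume d: "0 < d" "\<forall>(\<sigma>, \<mu>) \<in> path_nbhd \<Gamma> d \<zeta>. k + sum_entries \<mu> \<noteq> 0"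
      "path_nbhd \<Gamma> d \<zeta> \<inter> singular_manifold F k = {}"
      "d \<le> r \<or> regular_off_bundle F k (path_nbhd \<Gamma> d \<zeta>)"
    have "x = 0" if p: "(\<sigma>, \<mu>) \<in> path_nbhd \<Gamma> d \<zeta>" and x: "system_matrix F k \<sigma> \<mu> *v x = 0"
      for \<sigma> \<mu> x
    proof -
      consider "d \<le> r" | "(\<sigma>, \<mu>) \<in> fp_bundle F" | "invertible (system_matrix F k \<sigma> \<mu>)"
        using d(4) p by (auto simp: regular_off_bundle_def)
      then show ?thesis
      proof cases
        case 1
        show ?thesis by (rule r(2)[OF d(1) conjI[OF d(2,3)] 1 p x])
      next
        case 2
        then show ?thesis
          using d(2,3) p x by (intro system_matrix_kernel_on_bundle[of \<sigma> \<mu> F k x]) auto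
      next
        case 3
        then show ?thesis using x invertible_left_inverse matrix_left_invertible_ker by blast
      qed
    qed
    then show "\<exists>C\<^sub>2>0. \<forall>\<theta> \<mu> \<theta>' \<mu>' \<eta>.
       (softmax \<theta>, \<mu>) \<in> path_nbhd \<Gamma> d \<zeta> \<longrightarrow> 0 < \<eta> \<longrightarrow> \<eta> < 1 \<longrightarrow>
       path_step F k \<eta> \<theta> \<mu> \<theta>' \<mu>' \<longrightarrow>
       norm (G_tilde F (softmax \<theta>') \<mu>' - G_tilde F (softmax \<theta>) \<mu>) \<le> C\<^sub>2 * \<eta>"
      by (rule path_step_G_tilde_bound[OF F_C1 path zeta_nonneg])
  qed
qed

end
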